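(* Let $B\subset\mathbb R^2$ be a convex body and let $C_1\cup\dots\cup C_k=B$ be a convex partition of $B$ into nonempty sets. Then \[ \sum_{i=1}^k r_B(C_i)\ge 1. \]
   Context: A convex body is a compact convex set with nonempty interior. A (convex) partition of a convex set $X$ is a covering of $X$ by finitely many closed convex sets with pairwise disjoint interiors. For a convex body $B$ and a convex set $C$, $r_B(C)=\sup\{h\ge 0:\exists t\in\mathbb R^2,\ hB+t\subseteq C\}$, with $r_B(\emptyset)=-\infty$. *)

theory Defs
  imports "HOL-Analysis.Analysis" "HOL-Library.Extended_Real"
begin

definition convex_body :: "(real^2) set \<Rightarrow> bool" where
  "convex_body B \<longleftrightarrow> compact B \<and> convex B \<and> interior B \<noteq> {}"

text \<open>r_B(C) = sup of h >= 0 such that some translate of hB lies in C;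
  the supremum of the empty set in ereal is -infinity, matching r_B(empty) = -infinity.\<close>
definition rB :: "(real^2) set \<Rightarrow> (real^2) set \<Rightarrow> ereal" where
  "rB B C = Sup (ereal ` {h. h \<ge> 0 \<and> (\<exists>t. (\<lambda>x. h *\<^sub>R x + t) ` B \<subseteq> C)})"

definition convex_partition :: "(real^2) set \<Rightarrow> nat \<Rightarrow> (nat \<Rightarrow> (real^2) set) \<Rightarrow> bool" where
  "convex_partition X k C \<longleftrightarrow>
     (\<Union>i<k. C i) = X \<and>
     (\<forall>i<k. closed (C i) \<and> convex (C i)) \<and>
     (\<forall>i<k. \<forall>j<k. i \<noteq> j \<longrightarrow> interior (C i) \<inter> interior (C j) = {})"

end

(* Witness homothets depend on a partition in a convex way: if homothets h_i B + t_i lie in the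
   pieces V_i of a convex partition of the plane cut by a translate B_a of B, and likewise for B_b,
   then their convex combinations lie in V_i cut by the corresponding translate in between.  So
   extend the partition of B to one of the plane, and slide B in both directions along the normal
   of a line separating two pieces, until some piece only touches the translate.  The remaining
   pieces partition that translate, and induction on the number of pieces applies; the lost piece
   takes part with a point, i.e. with coefficient 0.

   A partition of B extends to the plane, one edge at a time, when B is a polygon.  A general B
   contains a polygon that contains a copy of (1 - e) B. *)
theory Submission
  imports Defs
begin

section \<open>Closed covers, separation and polytopes\<close>

lemma interior_finite_UN_closed_empty:
  fixes A :: "'i \<Rightarrow> 'a::topological_space set"
  assumes "finite I" "\<And>i. i \<in> I \<Longrightarrow> closed (A i)" "\<And>i. i \<in> I \<Longrightarrow> interior (A i) = {}"
  shows "interior (\<Union>i\<in>I. A i) = {}"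
  using assms
proof (induction I rule: finite_induct)
  case (insert i I)
  have "interior (A i \<union> (\<Union>i\<in>I. A i)) = interior (A i)"
    by (rule interior_closed_Un_empty_interior) (use insert in auto)
  then show ?case using insert by simp
qed simp

text \<open>The members without interior are thin even taken together, so the other members already
  cover the interior of \<open>X\<close>. Their union is closed and hence contains the closure of
  that interior. This is what allows thin pieces to be discarded from a partition.\<close>

lemma closed_cover_nonempty_interior:
  fixes A :: "'i \<Rightarrow> 'a::topological_space set"
  assumes "finite I" "\<And>i. i \<in> I \<Longrightarrow> closed (A i)"
    and "X \<subseteq> closure (interior X)" "X \<subseteq> (\<Union>i\<in>I. A i)"
  shows "X \<subseteq> (\<Union>i\<in>{i\<in>I. interior (A i) \<noteq> {}}. A i)"
proof -
  let ?G = "\<Union>i\<in>{i\<in>I. interior (A i) \<noteq> {}}. A i"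
  let ?N = "\<Union>i\<in>{i\<in>I. interior (A i) = {}}. A i"
  have cl: "closed ?G" using assms by auto
  have "interior ?N = {}"
    by (rule interior_finite_UN_closed_empty) (use assms in auto)
  then have "interior (?G \<union> ?N) = interior ?G"
    by (rule interior_closed_Un_empty_interior[OF cl])
  moreover have "X \<subseteq> ?G \<union> ?N"
  proof
    fix x assume "x \<in> X"
    then obtain i where "i \<in> I" "x \<in> A i" using assms(4) by blast
    then show "x \<in> ?G \<union> ?N" by (cases "interior (A i) = {}") auto
  qed
  then have "interior X \<subseteq> interior (?G \<union> ?N)" by (rule interior_mono)
  ultimately have "interior X \<subseteq> ?G" using interior_subset[of ?G] by simp
  then show ?thesis
    using assms(3) closure_minimal[OF _ cl, of "interior X"] by simp
qed

text \<open>The disjoint interiors are separated first. The inequalities then pass to the closures,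
  and a closed convex set with interior points is the closure of its interior.\<close>

lemma separating_hyperplane_interior:
  fixes S T :: "'a::euclidean_space set"
  assumes "closed S" "convex S" "interior S \<noteq> {}"
    and "closed T" "convex T" "interior T \<noteq> {}"
    and "interior (S \<inter> T) = {}"
  obtains u c where "u \<noteq> 0" "\<And>x. x \<in> S \<Longrightarrow> u \<bullet> x \<le> c" "\<And>x. x \<in> T \<Longrightarrow> c \<le> u \<bullet> x"
proof -
  have "interior S \<inter> interior T = {}" using assms by (simp add: interior_Int)
  then obtain u c where u: "u \<noteq> 0" "\<forall>x\<in>interior S. u \<bullet> x \<le> c" "\<forall>x\<in>interior T. c \<le> u \<bullet> x"
    using separating_hyperplane_sets[of "interior S" "interior T"] assms by (auto simp: convex_interior)
  have "closure (interior S) \<subseteq> {x. u \<bullet> x \<le> c}" "closure (interior T) \<subseteq> {x. u \<bullet> x \<ge> c}"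
    using u by (intro closure_minimal closed_halfspace_le closed_halfspace_ge; blast)+
  then have "S \<subseteq> {x. u \<bullet> x \<le> c}" "T \<subseteq> {x. u \<bullet> x \<ge> c}"
    using assms by (simp_all add: convex_closure_interior)
  then show ?thesis using that u(1) by blast
qed

text \<open>Here \<open>d\<close> is \<open>a\<close> turned by a right angle, so \<open>a\<close>
  and \<open>d\<close> form an orthogonal basis of the plane. The last clause is specific to
  dimension two: a functional that is constant along the line is a multiple of
  \<open>a\<close>.\<close>

lemma line_parametrization:
  fixes a :: "real^2"
  assumes "a \<noteq> 0"
  obtains d z where "a \<bullet> z = b" "a \<bullet> d = 0"
    "\<And>x. a \<bullet> x = b \<Longrightarrow> \<exists>s. x = z + s *\<^sub>R d" "\<And>u. u \<bullet> d = 0 \<Longrightarrow> \<exists>r. u = r *\<^sub>R a"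
proof -
  define d :: "real^2" where "d = vector [- (a$2), a$1]"
  define z where "z = (b / (a \<bullet> a)) *\<^sub>R a"
  have aa: "a \<bullet> a = (a$1)^2 + (a$2)^2"
    by (simp add: inner_vec_def sum_2 power2_eq_square)
  have dd: "d$1 = - (a$2)" "d$2 = a$1" by (simp_all add: d_def)
  \<comment> \<open>The expansion of \<open>x\<close> in the basis \<open>a\<close>,
    \<open>d\<close>, multiplied by \<open>a \<bullet> a\<close> so that it becomes a polynomial
    identity in the coordinates.\<close>
  have key: "((a$1)^2 + (a$2)^2) *\<^sub>R x = (a \<bullet> x) *\<^sub>R a + (d \<bullet> x) *\<^sub>R d" for x
    by (simp add: vec_eq_iff forall_2 inner_vec_def sum_2 dd power2_eq_square algebra_simps)
  have key': "x = (a \<bullet> x / (a \<bullet> a)) *\<^sub>R a + (d \<bullet> x / (a \<bullet> a)) *\<^sub>R d" for x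
  proof -
    have "x = (1 / (a \<bullet> a)) *\<^sub>R ((a \<bullet> a) *\<^sub>R x)" using assms by simp
    also have "(a \<bullet> a) *\<^sub>R x = (a \<bullet> x) *\<^sub>R a + (d \<bullet> x) *\<^sub>R d" using key aa by simp
    finally show ?thesis by (simp add: scaleR_add_right)
  qed
  show ?thesis
  proof
    show "a \<bullet> z = b" using assms by (simp add: z_def)
    show "a \<bullet> d = 0" by (simp add: inner_vec_def sum_2 dd)
    show "\<exists>s. x = z + s *\<^sub>R d" if "a \<bullet> x = b" for x
      using key'[of x] that z_def by auto
    show "\<exists>r. u = r *\<^sub>R a" if "u \<bullet> d = 0" for u
      using key'[of u] that by (auto simp: inner_commute)
  qed
qed

text \<open>Every point of \<open>K\<close> is interior to a box inside \<open>U\<close>. By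
  compactness finitely many boxes suffice, and the hull of all their vertices stays in the convex
  set \<open>U\<close>.\<close>

lemma polytope_between_compact_open:
  fixes K U :: "'a::euclidean_space set"
  assumes "compact K" "open U" "convex U" "K \<subseteq> U"
  obtains P where "polytope P" "K \<subseteq> P" "P \<subseteq> U"
proof -
  have "\<exists>F. finite F \<and> convex hull F \<subseteq> U \<and> x \<in> interior (convex hull F)" if "x \<in> K" for x
  proof -
    have "x \<in> U" using that assms(4) by blast
    then obtain a b where ab: "cbox a b \<subseteq> U" "x \<in> box a b"
      by (rule open_contains_cbox[OF assms(2)])
    obtain F where F: "finite F" "cbox a b = convex hull F"
      by (rule closed_interval_as_convex_hull)
    have "x \<in> interior (convex hull F)" using ab F(2) interior_cbox[of a b] by simp
    then show ?thesis using ab F by auto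
  qed
  then have "\<forall>x\<in>K. \<exists>F. finite F \<and> convex hull F \<subseteq> U \<and> x \<in> interior (convex hull F)" by blast
  then obtain F where "\<forall>x\<in>K. finite (F x) \<and> convex hull (F x) \<subseteq> U \<and> x \<in> interior (convex hull (F x))"
    by (rule bchoice[THEN exE])
  then have F: "\<And>x. x \<in> K \<Longrightarrow> finite (F x)" "\<And>x. x \<in> K \<Longrightarrow> convex hull (F x) \<subseteq> U"
    "\<And>x. x \<in> K \<Longrightarrow> x \<in> interior (convex hull (F x))" by simp_all
  have "K \<subseteq> (\<Union>x\<in>K. interior (convex hull (F x)))" using F(3) by blast
  then obtain D where D: "D \<subseteq> K" "finite D" "K \<subseteq> (\<Union>x\<in>D. interior (convex hull (F x)))"
    by (rule compactE_image[OF assms(1) open_interior])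
  let ?P = "convex hull (\<Union>x\<in>D. F x)"
  show ?thesis
  proof
    show "polytope ?P" using D F by (intro polytope_convex_hull) auto
    have "convex hull (F x) \<subseteq> ?P" if "x \<in> D" for x
      using that by (intro hull_mono) auto
    then show "K \<subseteq> ?P" using D(3) interior_subset by blast
    have "F x \<subseteq> U" if "x \<in> D" for x using F(2) D(1) that hull_subset[of "F x" convex] by blast
    then show "?P \<subseteq> U" by (intro hull_minimal) (use assms in auto)
  qed
qed

section \<open>Ordering finitely many intervals on a line\<close>

lemma finite_key_enumeration:
  fixes m :: "'i \<Rightarrow> 'b::linorder"
  assumes "finite J" "inj_on m J"
  obtains w where "bij_betw w {..<card J} J"
    "\<And>n n'. n < n' \<Longrightarrow> n' < card J \<Longrightarrow> m (w n) < m (w n')"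
proof -
  define xs where "xs = sorted_list_of_set (m ` J)"
  have len: "length xs = card J" and set: "set xs = m ` J" and st: "sorted_wrt (<) xs"
    using assms by (auto simp: xs_def card_image)
  have dist: "distinct xs" by (simp add: xs_def)
  define w where "w n = inv_into J m (xs ! n)" for n
  have nth: "xs ! n \<in> m ` J" if "n < card J" for n
    using nth_mem[of n xs] that len set by simp
  have mw: "m (w n) = xs ! n" if "n < card J" for n
    unfolding w_def using nth[OF that] by (rule f_inv_into_f)
  have "bij_betw (\<lambda>n. xs ! n) {..<card J} (m ` J)"
    using bij_betw_nth[OF dist] len set by simp
  moreover have "bij_betw (inv_into J m) (m ` J) J"
    by (rule bij_betw_inv_into) (use assms in \<open>auto simp: bij_betw_def\<close>)
  ultimately have "bij_betw (inv_into J m \<circ> (\<lambda>n. xs ! n)) {..<card J} J"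
    by (rule bij_betw_trans)
  then have "bij_betw w {..<card J} J" unfolding w_def comp_def .
  moreover have "m (w n) < m (w n')" if "n < n'" "n' < card J" for n n'
    using that mw len st by (simp add: sorted_wrt_iff_nth_less)
  ultimately show ?thesis using that by blast
qed

text \<open>Only consecutive sets are known to be separated, by \<open>p n\<close>. The increasing
  markers \<open>m n\<close> link distant indices: with \<open>n = Suc k\<close>, the chain is
  \<open>p j \<le> m (Suc j) \<le> m k \<le> p k \<le> s\<close>.\<close>

lemma ordered_intervals_below_above:
  fixes p :: "nat \<Rightarrow> real"
  assumes mS: "\<And>n. n < M \<Longrightarrow> m n \<in> S n"
    and mono: "\<And>n n'. n < n' \<Longrightarrow> n' < M \<Longrightarrow> m n < m n'"
    and below: "\<And>n x. Suc n < M \<Longrightarrow> x \<in> S n \<Longrightarrow> x \<le> p n"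
    and above: "\<And>n x. Suc n < M \<Longrightarrow> x \<in> S (Suc n) \<Longrightarrow> p n \<le> x"
    and "n < M" "s \<in> S n" "j < n"
  shows "p j \<le> s"
proof (cases "Suc j = n")
  case True
  then show ?thesis using above assms by auto
next
  case False
  obtain k where k: "n = Suc k" using assms(7) by (cases n) auto
  have "j < k" using False assms(7) k by auto
  have "p j \<le> m (Suc j)" using above[of j "m (Suc j)"] mS[of "Suc j"] \<open>j < k\<close> k assms(5) by auto
  also have "\<dots> \<le> m k" using mono[of "Suc j" k] \<open>j < k\<close> k assms(5) by (cases "Suc j = k") auto
  also have "\<dots> \<le> p k" using below[of k "m k"] mS[of k] k assms(5) by auto
  also have "\<dots> \<le> s" using above[of k s] k assms by auto
  finally show ?thesis .
qed

text \<open>A point strictly between \<open>s\<close> and the marker \<open>m n\<close> lies in some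
  \<open>S l\<close>. If \<open>l > n\<close> it would lie beyond \<open>p n\<close>, and if
  \<open>l < n\<close> before the left separating value, but \<open>s\<close> and \<open>m n\<close>
  are both on the inner side of these values. So the open segment lies in \<open>S n\<close>, and
  closedness adds its end \<open>s\<close>. The hypothesis \<open>lo\<close> is phrased with
  \<open>n = Suc j\<close> because the first set has no left neighbour.\<close>

lemma ordered_intervals_mem:
  fixes p :: "nat \<Rightarrow> real"
  assumes mS: "\<And>n. n < M \<Longrightarrow> m n \<in> S n"
    and mono: "\<And>n n'. n < n' \<Longrightarrow> n' < M \<Longrightarrow> m n < m n'"
    and below: "\<And>n x. Suc n < M \<Longrightarrow> x \<in> S n \<Longrightarrow> x \<le> p n"
    and above: "\<And>n x. Suc n < M \<Longrightarrow> x \<in> S (Suc n) \<Longrightarrow> p n \<le> x"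
    and cl: "\<And>n. n < M \<Longrightarrow> closed (S n)"
    and E: "convex E" "E \<subseteq> (\<Union>n<M. S n)" "\<And>n. n < M \<Longrightarrow> S n \<subseteq> E"
    and n: "n < M" and s: "s \<in> E"
    and lo: "\<And>j. n = Suc j \<Longrightarrow> p j \<le> s" and hi: "Suc n < M \<Longrightarrow> s \<le> p n"
  shows "s \<in> S n"
proof (cases "s = m n")
  case True
  then show ?thesis using mS n by simp
next
  case False
  note A = ordered_intervals_below_above[of M m S p, OF mS mono below above]
  have "open_segment s (m n) \<subseteq> S n"
  proof
    fix r assume r: "r \<in> open_segment s (m n)"
    have "m n \<in> E" using E(3) mS n by blast
    then have "r \<in> E" using r s E(1) convex_contains_open_segment by blast
    then obtain l where l: "l < M" "r \<in> S l" using E(2) by auto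
    have rb: "min s (m n) < r" "r < max s (m n)"
      using r by (auto simp: open_segment_eq_real_ivl split: if_splits)
    consider "l = n" | "n < l" | "l < n" by linarith
    then show "r \<in> S n"
    proof cases
      case 1 then show ?thesis using l by simp
    next
      case 2
      then have "p n \<le> r" using A[of l r n] l by blast
      moreover have "m n \<le> p n" "s \<le> p n" using below[of n "m n"] mS[of n] hi 2 l n by auto
      ultimately show ?thesis using rb by auto
    next
      case 3
      then obtain k where k: "n = Suc k" by (cases n) auto
      have "r \<le> p l" using below[of l r] l 3 n by auto
      also have "p l \<le> p k"
      proof (cases "l = k")
        case False
        then have "p l \<le> m k" using A[of k "m k" l] mS[of k] 3 k n by auto
        also have "\<dots> \<le> p k" using below[of k "m k"] mS[of k] k n by auto
        finally show ?thesis .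
      qed simp
      finally have "r \<le> p k" .
      moreover have "p k \<le> m n" using above[of k "m n"] mS[of n] k n by auto
      ultimately show ?thesis using rb lo[OF k] by auto
    qed
  qed
  then have "closure (open_segment s (m n)) \<subseteq> S n" by (intro closure_minimal cl n)
  then show ?thesis using False by auto
qed

section \<open>Extending a partition of a polygon to the plane\<close>

definition solid_partition :: "'a::euclidean_space set \<Rightarrow> 'i set \<Rightarrow> ('i \<Rightarrow> 'a set) \<Rightarrow> bool" where
  "solid_partition U I C \<longleftrightarrow> finite I \<and> (\<Union>i\<in>I. C i) = U \<and>
     (\<forall>i\<in>I. closed (C i) \<and> convex (C i) \<and> interior (C i) \<noteq> {}) \<and>
     (\<forall>i\<in>I. \<forall>j\<in>I. i \<noteq> j \<longrightarrow> interior (C i \<inter> C j) = {})"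

text \<open>A separator parallel to the line \<open>a \<bullet> x = b\<close> would coincide with
  it, since both sets touch that line; this forces \<open>c = r * b\<close>. Both sets lie on the
  same side of the line, so one of them, depending on the sign of \<open>r\<close>, would be
  contained in the line and have no interior.\<close>

lemma separator_transversal:
  fixes a :: "'a::euclidean_space"
  assumes "a \<noteq> 0" "u \<noteq> 0"
    and par: "u \<bullet> d = 0 \<Longrightarrow> \<exists>r. u = r *\<^sub>R a"
    and line: "a \<bullet> z = b" "a \<bullet> d = 0"
    and S: "\<And>x. x \<in> S \<Longrightarrow> a \<bullet> x \<le> b" "\<And>x. x \<in> S \<Longrightarrow> u \<bullet> x \<le> c" "interior S \<noteq> {}"
    and T: "\<And>x. x \<in> T \<Longrightarrow> a \<bullet> x \<le> b" "\<And>x. x \<in> T \<Longrightarrow> c \<le> u \<bullet> x" "interior T \<noteq> {}"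
    and "z + s *\<^sub>R d \<in> S" "z + t *\<^sub>R d \<in> T"
  shows "u \<bullet> d \<noteq> 0"
proof
  assume "u \<bullet> d = 0"
  with par obtain r where r: "u = r *\<^sub>R a" by blast
  have "r * b \<le> c" using S(2)[OF assms(12)] by (simp add: r inner_add_right line)
  moreover have "c \<le> r * b" using T(2)[OF assms(13)] by (simp add: r inner_add_right line)
  ultimately have c: "c = r * b" by simp
  have r0: "r \<noteq> 0" using r assms(2) by auto
  have hyp: "interior {x. a \<bullet> x = b} = {}"
    using assms(1) by (simp add: interior_hyperplane)
  consider "r > 0" | "r < 0" using r0 by linarith
  then show False
  proof cases
    case 1
    have "T \<subseteq> {x. a \<bullet> x = b}" using T(1,2) 1 by (force simp: r c)
    then show False using hyp T(3) interior_mono by blast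
  next
    case 2
    have "S \<subseteq> {x. a \<bullet> x = b}" using S(1,2) 2 by (force simp: r c)
    then show False using hyp S(3) interior_mono by blast
  qed
qed

text \<open>A segment from \<open>S\<close> to \<open>T\<close> meets the hyperplane in a point of
  both sets, which splits it into a part inside \<open>S\<close> and a part inside
  \<open>T\<close>.\<close>

lemma convex_Un_across_hyperplane:
  fixes a :: "'a::euclidean_space"
  assumes "convex S" "convex T"
    and S: "\<And>x. x \<in> S \<Longrightarrow> a \<bullet> x \<le> b" and T: "\<And>x. x \<in> T \<Longrightarrow> b \<le> a \<bullet> x"
    and cross: "\<And>x y z. x \<in> S \<Longrightarrow> y \<in> T \<Longrightarrow> z \<in> closed_segment x y \<Longrightarrow> a \<bullet> z = b \<Longrightarrow> z \<in> S \<inter> T"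
  shows "convex (S \<union> T)"
proof -
  have main: "closed_segment x y \<subseteq> S \<union> T" if xy: "x \<in> S" "y \<in> T" for x y
  proof -
    obtain z where z: "z \<in> closed_segment x y" "a \<bullet> z = b"
    proof (cases "a \<bullet> x = a \<bullet> y")
      case True
      then show ?thesis using that[of x] S[OF xy(1)] T[OF xy(2)] by auto
    next
      case False
      then have lt: "a \<bullet> x < a \<bullet> y" using S[OF xy(1)] T[OF xy(2)] by linarith
      define v where "v = (b - a \<bullet> x) / (a \<bullet> y - a \<bullet> x)"
      have v: "0 \<le> v" "v \<le> 1" using lt S[OF xy(1)] T[OF xy(2)] by (auto simp: v_def divide_simps)
      have "a \<bullet> ((1 - v) *\<^sub>R x + v *\<^sub>R y) = a \<bullet> x + v * (a \<bullet> y - a \<bullet> x)"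
        by (simp add: inner_add_right algebra_simps)
      also have "\<dots> = b" using lt by (simp add: v_def)
      finally show ?thesis using that[of "(1 - v) *\<^sub>R x + v *\<^sub>R y"] v by (auto simp: in_segment)
    qed
    then have zz: "z \<in> S" "z \<in> T" using cross[OF xy] by auto
    have "closed_segment x y = closed_segment x z \<union> closed_segment z y"
      using Un_closed_segment[OF z(1)] by simp
    then show ?thesis
      using closed_segment_subset[OF xy(1) zz(1) assms(1)] closed_segment_subset[OF zz(2) xy(2) assms(2)] by blast
  qed
  show ?thesis
    unfolding convex_contains_segment
  proof (intro ballI)
    fix x y assume "x \<in> S \<union> T" "y \<in> S \<union> T"
    then consider "x \<in> S" "y \<in> S" | "x \<in> T" "y \<in> T" | "x \<in> S" "y \<in> T" | "x \<in> T" "y \<in> S" by blast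
    then show "closed_segment x y \<subseteq> S \<union> T"
    proof cases
      case 1 then show ?thesis using closed_segment_subset[OF _ _ assms(1)] by blast
    next
      case 2 then show ?thesis using closed_segment_subset[OF _ _ assms(2)] by blast
    next
      case 3 then show ?thesis using main by blast
    next
      case 4 then show ?thesis using main closed_segment_commute by metis
    qed
  qed
qed

text \<open>The pieces meet the line in intervals, possibly degenerate, which are ordered along it.
  Separators of consecutive pieces are prolonged beyond the line and cut the far side of
  \<open>U\<close> into cells \<open>T n\<close>. A cell has the same trace on the line as its
  piece, so gluing the two gives a convex set by \<open>convex_Un_across_hyperplane\<close>.\<close>

lemma extend_across_line:
  fixes C :: "'i \<Rightarrow> (real^2) set"
  assumes part: "solid_partition (U \<inter> {x. a \<bullet> x \<le> b}) I C"
    and U: "closed U" "convex U" and a: "a \<noteq> 0" and I: "I \<noteq> {}"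
  obtains V where "solid_partition U I V" "\<And>i. i \<in> I \<Longrightarrow> V i \<inter> {x. a \<bullet> x \<le> b} = C i"
proof (cases "U \<subseteq> {x. a \<bullet> x \<le> b}")
  case True
  then have eq: "U \<inter> {x. a \<bullet> x \<le> b} = U" by blast
  have "C i \<inter> {x. a \<bullet> x \<le> b} = C i" if "i \<in> I" for i
  proof -
    have "C i \<subseteq> U \<inter> {x. a \<bullet> x \<le> b}"
      using part that unfolding solid_partition_def by (elim conjE) (erule subst, rule UN_upper)
    then show ?thesis by blast
  qed
  then show ?thesis using that[of C] part eq by simp
next
  case False
  then obtain y where "y \<in> U" "\<not> a \<bullet> y \<le> b" by auto
  then have y: "y \<in> U" "a \<bullet> y > b" by simp_all
  have fin: "finite I" and cov: "(\<Union>i\<in>I. C i) = U \<inter> {x. a \<bullet> x \<le> b}"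
    and Ccl: "\<And>i. i \<in> I \<Longrightarrow> closed (C i)" and Ccv: "\<And>i. i \<in> I \<Longrightarrow> convex (C i)"
    and Cint: "\<And>i. i \<in> I \<Longrightarrow> interior (C i) \<noteq> {}"
    and Cdis: "\<And>i j. i \<in> I \<Longrightarrow> j \<in> I \<Longrightarrow> i \<noteq> j \<Longrightarrow> interior (C i \<inter> C j) = {}"
    using part by (simp_all add: solid_partition_def)
  have Cle: "a \<bullet> x \<le> b" and CU: "x \<in> U" if "i \<in> I" "x \<in> C i" for i x
    using UN_upper[OF that(1), of C, unfolded cov] that(2) by auto
  obtain d z where az: "a \<bullet> z = b" and ad: "a \<bullet> d = 0"
    and onl: "\<And>x. a \<bullet> x = b \<Longrightarrow> \<exists>s. x = z + s *\<^sub>R d"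
    and par: "\<And>u. u \<bullet> d = 0 \<Longrightarrow> \<exists>r. u = r *\<^sub>R a"
    by (rule line_parametrization[OF a, of b], rule that)
  define L where "L s = z + s *\<^sub>R d" for s :: real
  have aL: "a \<bullet> L s = b" for s by (simp add: L_def inner_add_right az ad)
  have Lcont: "isCont L s" for s unfolding L_def by (intro continuous_intros)
  have vcl: "closed (L -` X)" if "closed X" for X
    by (rule continuous_closed_vimage[OF that Lcont])
  have vcv: "convex (L -` X)" if "convex X" for X
  proof -
    have "L ((1 - v) *\<^sub>R s + v *\<^sub>R t) = (1 - v) *\<^sub>R L s + v *\<^sub>R L t" for s t v
      by (simp add: L_def algebra_simps)
    then show ?thesis using that unfolding convex_alt by auto
  qed
  define E where "E = L -` U"
  define S where "S i = L -` C i" for i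
  have Ecv: "convex E" unfolding E_def using vcv U by auto
  have Scv: "convex (S i)" and Scl: "closed (S i)" if "i \<in> I" for i
    unfolding S_def using that vcv vcl Ccl Ccv by auto
  have Ecov: "E = (\<Union>i\<in>I. S i)"
  proof -
    have "(L s \<in> U) = (\<exists>i\<in>I. L s \<in> C i)" for s using cov aL[of s] by blast
    then show ?thesis unfolding E_def S_def by auto
  qed
  \<comment> \<open>The segment from an interior point \<open>x\<close> before the line to the point
    \<open>y\<close> beyond it crosses the line at \<open>q\<close>, which is still interior to
    \<open>U\<close>. The form of \<open>q\<close> is the one used in
    \<open>mem_interior_convex_shrink\<close>.\<close>
  have Eint: "interior E \<noteq> {}"
  proof -
    obtain i where i: "i \<in> I" using I by blast
    then obtain x where x: "x \<in> interior (C i)" using Cint by blast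
    have "C i \<subseteq> U" "C i \<subseteq> {x. a \<bullet> x \<le> b}" using CU Cle i by blast+
    then have "interior (C i) \<subseteq> interior U" "interior (C i) \<subseteq> {x. a \<bullet> x < b}"
      using interior_halfspace_le[OF a, of b] by (metis interior_mono)+
    then have xU: "x \<in> interior U" and xl: "a \<bullet> x < b" using x by auto
    define v where "v = (b - a \<bullet> x) / (a \<bullet> y - a \<bullet> x)"
    define q where "q = y - (1 - v) *\<^sub>R (y - x)"
    have v: "0 < v" "v < 1" using xl y by (auto simp: v_def divide_simps)
    have "q \<in> interior U" unfolding q_def
      by (rule mem_interior_convex_shrink) (use U xU y v in auto)
    have "a \<bullet> q = a \<bullet> x + v * (a \<bullet> y - a \<bullet> x)"
      by (simp add: q_def inner_diff_right algebra_simps)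
    also have "\<dots> = b" using xl y by (simp add: v_def)
    finally obtain s where "q = L s" using onl by (auto simp: L_def)
    have "open (L -` interior U)"
      by (rule continuous_open_vimage[OF open_interior Lcont])
    moreover have "L -` interior U \<subseteq> E" using interior_subset by (auto simp: E_def)
    ultimately have "L -` interior U \<subseteq> interior E" by (simp add: interior_maximal)
    then show ?thesis using \<open>q = L s\<close> \<open>q \<in> interior U\<close> by auto
  qed
  \<comment> \<open>Pieces that touch the line in at most one point are not extended.\<close>
  define J where "J = {i\<in>I. interior (S i) \<noteq> {}}"
  have finJ: "finite J" and JI: "\<And>i. i \<in> J \<Longrightarrow> i \<in> I" using fin by (auto simp: J_def)
  have "E \<subseteq> closure (interior E)"
    using convex_closure_interior[OF Ecv Eint] closure_subset[of E] by simp
  then have EJ: "E \<subseteq> (\<Union>i\<in>J. S i)"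
    unfolding J_def by (intro closed_cover_nonempty_interior fin Scl) (simp_all add: Ecov)
  have sep: "\<exists>u c. u \<noteq> 0 \<and> u \<bullet> d \<noteq> 0 \<and> (\<forall>x\<in>C i. u \<bullet> x \<le> c) \<and> (\<forall>x\<in>C j. c \<le> u \<bullet> x)"
    if ij: "i \<in> J" "j \<in> J" "i \<noteq> j" for i j
  proof -
    have I: "i \<in> I" "j \<in> I" using ij JI by auto
    obtain u c where u: "u \<noteq> 0" "\<And>x. x \<in> C i \<Longrightarrow> u \<bullet> x \<le> c" "\<And>x. x \<in> C j \<Longrightarrow> c \<le> u \<bullet> x"
      using separating_hyperplane_interior[OF Ccl Ccv Cint Ccl Ccv Cint Cdis, OF I(1) I(1) I(1) I(2) I(2) I(2) I ij(3)]
      by blast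
    obtain s t where "s \<in> interior (S i)" "t \<in> interior (S j)" using ij unfolding J_def by blast
    then have st: "s \<in> S i" "t \<in> S j" using interior_subset by auto
    have "u \<bullet> d \<noteq> 0"
      by (rule separator_transversal[OF a u(1) par az ad _ u(2) _ _ u(3), of "C i" "C j" s t])
         (use ij JI Cle Cint st in \<open>auto simp: S_def L_def\<close>)
    then show ?thesis using u by blast
  qed
  have "\<forall>i\<in>J. \<exists>s. s \<in> interior (S i)" by (auto simp: J_def)
  from bchoice[OF this] obtain m where m: "\<And>i. i \<in> J \<Longrightarrow> m i \<in> interior (S i)" by blast
  then have mS: "m i \<in> S i" if "i \<in> J" for i using that interior_subset[of "S i"] by blast
  \<comment> \<open>If two markers coincided, the two traces would share two distinct points of the
    line. The separator would take the value \<open>c\<close> at both, although it is not constant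
    along the line.\<close>
  have inj: "inj_on m J"
  proof (rule inj_onI, rule ccontr)
    fix i j assume ij: "i \<in> J" "j \<in> J" "m i = m j" "i \<noteq> j"
    then obtain u c where u: "u \<bullet> d \<noteq> 0" "\<forall>x\<in>C i. u \<bullet> x \<le> c" "\<forall>x\<in>C j. c \<le> u \<bullet> x"
      using sep by blast
    have "m i \<in> interior (S i \<inter> S j)" using m[OF ij(1)] m[OF ij(2)] ij(3) by simp
    then obtain e where e: "e > 0" "cball (m i) e \<subseteq> S i \<inter> S j"
      using mem_interior_cball by blast
    have "m i \<in> cball (m i) e" "m i + e \<in> cball (m i) e" using e(1) by (auto simp: dist_real_def)
    then have "m i \<in> S i \<inter> S j" "m i + e \<in> S i \<inter> S j" using e(2) by blast+
    then have "u \<bullet> L (m i) = c" "u \<bullet> L (m i + e) = c"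
      using u(2,3) by (auto simp: S_def intro!: antisym)
    moreover have "u \<bullet> L (m i + e) = u \<bullet> L (m i) + e * (u \<bullet> d)"
      by (simp add: L_def inner_add_right algebra_simps)
    ultimately have "e * (u \<bullet> d) = 0" by simp
    then show False using e(1) u(1) by simp
  qed
  define M where "M = card J"
  obtain w where w: "bij_betw w {..<M} J"
    and wm: "\<And>n n'. n < n' \<Longrightarrow> n' < M \<Longrightarrow> m (w n) < m (w n')"
    using finite_key_enumeration[OF finJ inj, folded M_def] by blast
  have wJ: "w n \<in> J" if "n < M" for n using bij_betwE[OF w] that by simp
  have wI: "w n \<in> I" if "n < M" for n using wJ[OF that] JI by blast
  have winj: "n = n'" if "w n = w n'" "n < M" "n' < M" for n n'
    using w that unfolding bij_betw_def inj_on_def by simp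
  have "J \<noteq> {}" using EJ Eint interior_subset by fastforce
  then have M0: "M > 0" using finJ by (simp add: M_def card_gt_0_iff)
  \<comment> \<open>The marker of piece \<open>w n\<close> precedes that of
    \<open>w (Suc n)\<close>, so the separator increases along \<open>d\<close>. All separators thus
    have the same orientation, and each becomes a bound on the line parameter.\<close>
  have "\<forall>n\<in>{n. Suc n < M}. \<exists>uc. fst uc \<noteq> 0 \<and> fst uc \<bullet> d > 0 \<and>
      (\<forall>x\<in>C (w n). fst uc \<bullet> x \<le> snd uc) \<and> (\<forall>x\<in>C (w (Suc n)). snd uc \<le> fst uc \<bullet> x)"
  proof
    fix n assume "n \<in> {n. Suc n < M}"
    then have n: "Suc n < M" "n < M" by auto
    have "w n \<noteq> w (Suc n)" using winj n by fastforce
    then obtain u c where u: "u \<noteq> 0" "u \<bullet> d \<noteq> 0" "\<forall>x\<in>C (w n). u \<bullet> x \<le> c" "\<forall>x\<in>C (w (Suc n)). c \<le> u \<bullet> x"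
      using sep[OF wJ[OF n(2)] wJ[OF n(1)]] by blast
    have "u \<bullet> L (m (w n)) \<le> c" "c \<le> u \<bullet> L (m (w (Suc n)))"
      using u mS[OF wJ[OF n(1)]] mS[OF wJ[OF n(2)]] by (auto simp: S_def)
    moreover have "(m (w (Suc n)) - m (w n)) * (u \<bullet> d) = u \<bullet> L (m (w (Suc n))) - u \<bullet> L (m (w n))"
      by (simp add: L_def inner_add_right algebra_simps)
    ultimately have "0 \<le> (m (w (Suc n)) - m (w n)) * (u \<bullet> d)" by linarith
    moreover have "m (w n) < m (w (Suc n))" using wm n by simp
    ultimately have "u \<bullet> d > 0" using u(2) by (simp add: zero_le_mult_iff)
    then show "\<exists>uc. fst uc \<noteq> 0 \<and> fst uc \<bullet> d > 0 \<and>
      (\<forall>x\<in>C (w n). fst uc \<bullet> x \<le> snd uc) \<and> (\<forall>x\<in>C (w (Suc n)). snd uc \<le> fst uc \<bullet> x)"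
      using u by (intro exI[of _ "(u, c)"]) simp
  qed
  from bchoice[OF this] obtain f where f: "\<And>n. Suc n < M \<Longrightarrow> fst (f n) \<noteq> 0" "\<And>n. Suc n < M \<Longrightarrow> fst (f n) \<bullet> d > 0"
      "\<And>n x. Suc n < M \<Longrightarrow> x \<in> C (w n) \<Longrightarrow> fst (f n) \<bullet> x \<le> snd (f n)"
      "\<And>n x. Suc n < M \<Longrightarrow> x \<in> C (w (Suc n)) \<Longrightarrow> snd (f n) \<le> fst (f n) \<bullet> x"
    by auto
  define u where "u n = fst (f n)" for n
  define c where "c n = snd (f n)" for n
  have u0: "u n \<noteq> 0" and ud: "u n \<bullet> d > 0" if "Suc n < M" for n using f(1,2)[OF that] by (auto simp: u_def)
  have uC: "u n \<bullet> x \<le> c n" if "Suc n < M" "x \<in> C (w n)" for n x using f(3) that by (simp add: u_def c_def)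
  have uC': "c n \<le> u n \<bullet> x" if "Suc n < M" "x \<in> C (w (Suc n))" for n x using f(4) that by (simp add: u_def c_def)
  \<comment> \<open>The parameter at which the separator number \<open>n\<close> crosses the
    line.\<close>
  define p where "p n = (c n - u n \<bullet> z) / (u n \<bullet> d)" for n
  have ple: "u n \<bullet> L s \<le> c n \<longleftrightarrow> s \<le> p n" and pge: "c n \<le> u n \<bullet> L s \<longleftrightarrow> p n \<le> s" if "Suc n < M" for n s
    using ud[OF that] by (auto simp: p_def L_def inner_add_right field_simps)
  note mw = mS[OF wJ]
  have below: "x \<le> p n" if "Suc n < M" "x \<in> S (w n)" for n x
    using that uC ple by (auto simp: S_def)
  have above: "p n \<le> x" if "Suc n < M" "x \<in> S (w (Suc n))" for n x
    using that uC' pge by (auto simp: S_def)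
  note Aord = ordered_intervals_below_above[of M "\<lambda>n. m (w n)" "\<lambda>n. S (w n)" p, OF mw wm below above]
  have Ew: "E \<subseteq> (\<Union>n<M. S (w n))" using EJ w by (force simp: bij_betw_def)
  have SE: "S (w n) \<subseteq> E" if "n < M" for n using Ecov wI[OF that] by blast
  have Bord: "s \<in> S (w n)" if "n < M" "s \<in> E" "\<And>j. n = Suc j \<Longrightarrow> p j \<le> s" "Suc n < M \<Longrightarrow> s \<le> p n" for n s
    by (rule ordered_intervals_mem[of M "\<lambda>n. m (w n)" "\<lambda>n. S (w n)" p, OF mw wm below above Scl[OF wI] Ecv Ew SE])
       (use that in auto)
  \<comment> \<open>Beyond the line, a point goes to the first piece whose right separator it does not pass.  The
    cells cover for trivial reasons, whereas cells bounded by both separators would overlap or leave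
    gaps as soon as two separators cross.\<close>
  define R where "R n = {x. (\<forall>j<n. c j \<le> u j \<bullet> x) \<and> (Suc n < M \<longrightarrow> u n \<bullet> x \<le> c n)}" for n
  have Req: "R n = (\<Inter>j\<in>{..<n}. {x. c j \<le> u j \<bullet> x}) \<inter> (if Suc n < M then {x. u n \<bullet> x \<le> c n} else UNIV)" for n
    by (auto simp: R_def)
  have Rcl: "closed (R n)" and Rcv: "convex (R n)" for n
    unfolding Req by (auto intro!: closed_Int closed_INT convex_Int convex_INT closed_halfspace_le closed_halfspace_ge
      convex_halfspace_le convex_halfspace_ge)
  define T where "T n = U \<inter> {x. b \<le> a \<bullet> x} \<inter> R n" for n
  have Tcl: "closed (T n)" and Tcv: "convex (T n)" for n
    unfolding T_def by (intro closed_Int convex_Int U Rcl Rcv closed_halfspace_ge convex_halfspace_ge)+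
  have lineR: "x \<in> T n" if "n < M" "x \<in> C (w n)" "a \<bullet> x = b" for n x
  proof -
    obtain s where s: "x = L s" using onl \<open>a \<bullet> x = b\<close> by (auto simp: L_def)
    then have sS: "s \<in> S (w n)" using that by (simp add: S_def)
    have "c j \<le> u j \<bullet> x" if "j < n" for j
      using Aord[of n s j] \<open>n < M\<close> sS that pge[of j s] s by simp
    moreover have "Suc n < M \<longrightarrow> u n \<bullet> x \<le> c n" using uC that by blast
    ultimately show ?thesis using that CU[OF wI] by (simp add: T_def R_def)
  qed
  have lineC: "x \<in> C (w n)" if "n < M" "x \<in> U" "a \<bullet> x = b"
    "\<And>j. n = Suc j \<Longrightarrow> c j \<le> u j \<bullet> x" "Suc n < M \<Longrightarrow> u n \<bullet> x \<le> c n" for n x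
  proof -
    obtain s where s: "x = L s" using onl \<open>a \<bullet> x = b\<close> by (auto simp: L_def)
    have "s \<in> S (w n)" using Bord[of n s] that s ple pge by (auto simp: E_def)
    then show ?thesis by (simp add: S_def s)
  qed
  have conv: "convex (C (w n) \<union> T n)" if n: "n < M" for n
  proof (rule convex_Un_across_hyperplane[of _ _ a b])
    show "convex (C (w n))" "convex (T n)" using Ccv wI n Tcv by auto
    show "a \<bullet> x \<le> b" if "x \<in> C (w n)" for x using Cle wI n that by blast
    show "b \<le> a \<bullet> x" if "x \<in> T n" for x using that by (simp add: T_def)
    fix x y q assume *: "x \<in> C (w n)" "y \<in> T n" "q \<in> closed_segment x y" "a \<bullet> q = b"
    have "x \<in> U" "y \<in> U" using * CU wI n by (auto simp: T_def)
    have qK: "q \<in> K" if "x \<in> K" "y \<in> K" "convex K" for K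
      using closed_segment_subset[OF that] *(3) by blast
    have qU: "q \<in> U" using qK \<open>x \<in> U\<close> \<open>y \<in> U\<close> U(2) by simp
    \<comment> \<open>All of the piece is known to satisfy only the bounds of its own neighbouring
      separators, so only these are passed on to \<open>q\<close>. They suffice for
      \<open>lineC\<close>; afterwards \<open>lineR\<close> supplies the bounds from the earlier
      separators.\<close>
    have 1: "c j \<le> u j \<bullet> q" if "n = Suc j" for j
      using qK[OF _ _ convex_halfspace_ge[of "c j" "u j"]] uC'[of j x] * n that by (simp add: T_def R_def)
    have 2: "u n \<bullet> q \<le> c n" if "Suc n < M"
      using qK[OF _ _ convex_halfspace_le[of "u n" "c n"]] uC[of n x] * that by (simp add: T_def R_def)
    have "q \<in> C (w n)" using lineC[OF n qU *(4) 1 2] .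
    then show "q \<in> C (w n) \<inter> T n" using lineR[OF n _ *(4)] by blast
  qed
  \<comment> \<open>\<open>N i\<close> is a singleton for an extended piece and empty otherwise, so
    that one formula for \<open>V\<close> serves both cases.\<close>
  define N where "N i = {n. n < M \<and> w n = i}" for i
  have N: "N (w n) = {n}" if "n < M" for n using that winj by (auto simp: N_def)
  have N0: "N i = {} \<or> (\<exists>n<M. w n = i \<and> N i = {n})" for i
  proof (cases "N i = {}")
    case False
    then obtain n where n: "n < M" "w n = i" by (auto simp: N_def)
    then show ?thesis using N by blast
  qed simp
  define V where "V i = C i \<union> (\<Union>n\<in>N i. T n)" for i
  have V: "V i = C i \<or> (\<exists>n<M. w n = i \<and> V i = C (w n) \<union> T n)" for i
    using N0[of i] by (auto simp: V_def)
  have line0: "interior {x. a \<bullet> x = b} = {}" using a by (simp add: interior_hyperplane)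
  have "solid_partition U I V"
    unfolding solid_partition_def
  proof (intro conjI ballI impI)
    show "finite I" by fact
    have VU: "V i \<subseteq> U" if "i \<in> I" for i using CU[OF that] by (auto simp: V_def T_def)
    have "x \<in> (\<Union>i\<in>I. V i)" if x: "x \<in> U" for x
    proof (cases "a \<bullet> x \<le> b")
      case True
      then obtain i where "i \<in> I" "x \<in> C i" using x cov by blast
      then show ?thesis by (auto simp: V_def)
    next
      case False
      \<comment> \<open>The least index exists because the condition is vacuous at
        \<open>M - 1\<close>, the last piece, which has no right separator.\<close>
      define n where "n = (LEAST n. Suc n < M \<longrightarrow> u n \<bullet> x \<le> c n)"
      have n1: "Suc n < M \<longrightarrow> u n \<bullet> x \<le> c n" unfolding n_def
        by (rule LeastI[of "\<lambda>n. Suc n < M \<longrightarrow> u n \<bullet> x \<le> c n" "M - 1"]) (use M0 in simp)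
      have "n \<le> M - 1" unfolding n_def by (rule Least_le) (use M0 in simp)
      then have n: "n < M" using M0 by simp
      have "c j \<le> u j \<bullet> x" if "j < n" for j using not_less_Least[OF that[unfolded n_def]] by simp
      then have "x \<in> T n" using n1 x False by (simp add: T_def R_def)
      then have "x \<in> V (w n)" using n by (auto simp: V_def N_def)
      then show ?thesis using wI n by blast
    qed
    then show "(\<Union>i\<in>I. V i) = U" using VU by blast
    show "closed (V i)" if i: "i \<in> I" for i
      using V[of i]
    proof
      assume "\<exists>n<M. w n = i \<and> V i = C (w n) \<union> T n"
      then obtain n where n: "w n = i" "V i = C (w n) \<union> T n" by blast
      show ?thesis unfolding n(2) by (rule closed_Un[OF Ccl Tcl]) (use n i in simp)
    qed (simp add: Ccl i)
    show "convex (V i)" if "i \<in> I" for i using V[of i] Ccv[OF that] conv by auto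
    show "interior (V i) \<noteq> {}" if "i \<in> I" for i
      using interior_mono[of "C i" "V i"] Cint[OF that] by (auto simp: V_def)
    \<comment> \<open>Two extended pieces can overlap only in the old overlap, on the boundary line,
      or in two cells. The cells with \<open>n < n'\<close> lie on opposite sides of the separator
      \<open>n\<close>, so they share only points of that separator. \<open>T'\<close> is empty when
      one of the pieces is not extended.\<close>
    have aux: "interior (V i \<inter> V j) = {}"
      if ij: "i \<in> I" "j \<in> I" "i \<noteq> j" and T: "T' = {} \<or> (\<exists>n n'. n < n' \<and> n' < M \<and> T' = T n \<inter> T n')"
        and sub: "V i \<inter> V j \<subseteq> (C i \<inter> C j) \<union> ({x. a \<bullet> x = b} \<union> T')" for i j T'
    proof -
      have "interior T' = {}"
        using T
      proof
        assume "\<exists>n n'. n < n' \<and> n' < M \<and> T' = T n \<inter> T n'"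
        then obtain n n' where n: "n < n'" "n' < M" "T' = T n \<inter> T n'" by blast
        then have "T' \<subseteq> {x. u n \<bullet> x = c n}" by (auto simp: T_def R_def intro: antisym)
        moreover have "interior {x. u n \<bullet> x = c n} = {}" using u0[of n] n by (simp add: interior_hyperplane)
        ultimately show ?thesis using interior_mono[of T' "{x. u n \<bullet> x = c n}"] by simp
      qed simp
      then have "interior ({x. a \<bullet> x = b} \<union> T') = {}"
        using interior_closed_Un_empty_interior[OF closed_hyperplane, of T' a b] line0 by simp
      then have "interior ((C i \<inter> C j) \<union> ({x. a \<bullet> x = b} \<union> T')) = interior (C i \<inter> C j)"
        using interior_closed_Un_empty_interior[OF closed_Int[OF Ccl[OF ij(1)] Ccl[OF ij(2)]], of "{x. a \<bullet> x = b} \<union> T'"] by simp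
      then show ?thesis using interior_mono[OF sub] Cdis[OF ij] by (simp only: subset_empty)
    qed
    show "interior (V i \<inter> V j) = {}" if ij: "i \<in> I" "j \<in> I" "i \<noteq> j" for i j
    proof -
      have CT: "x \<in> C k \<Longrightarrow> x \<in> T n \<Longrightarrow> k \<in> I \<Longrightarrow> a \<bullet> x = b" for x k n
        using Cle[of k x] by (auto simp: T_def intro: antisym)
      consider "N i = {} \<or> N j = {}" | n n' where "n < M" "w n = i" "N i = {n}" "n' < M" "w n' = j" "N j = {n'}"
        using N0[of i] N0[of j] by blast
      then show ?thesis
      proof cases
        case 1
        show ?thesis
          by (rule aux[OF ij, of "{}"]) (use 1 CT ij in \<open>auto simp: V_def\<close>)
      next
        case 2
        then have "n < n' \<or> n' < n" using ij by auto
        then have "\<exists>k k'. k < k' \<and> k' < M \<and> T n \<inter> T n' = T k \<inter> T k'"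
          using 2 by (metis Int_commute)
        then show ?thesis
          by (intro aux[OF ij, of "T n \<inter> T n'"]) (use 2 CT ij in \<open>auto simp: V_def\<close>)
      qed
    qed
  qed
  moreover have "V i \<inter> {x. a \<bullet> x \<le> b} = C i" if i: "i \<in> I" for i
  proof
    show "C i \<subseteq> V i \<inter> {x. a \<bullet> x \<le> b}" using Cle[OF i] by (auto simp: V_def)
    show "V i \<inter> {x. a \<bullet> x \<le> b} \<subseteq> C i"
    proof
      fix x assume x: "x \<in> V i \<inter> {x. a \<bullet> x \<le> b}"
      show "x \<in> C i"
      proof (rule ccontr)
        assume "x \<notin> C i"
        then obtain n where n: "n < M" "w n = i" "x \<in> T n" using x by (auto simp: V_def N_def)
        then have "x \<in> C (w n)" using x by (intro lineC) (auto simp: T_def R_def)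
        then show False using n \<open>x \<notin> C i\<close> by simp
      qed
    qed
  qed
  ultimately show ?thesis using that by blast
qed

text \<open>The half-planes that bound the polygon are dropped one at a time, each by
  \<open>extend_across_line\<close>. The pieces grow on the way, hence the induction is for
  arbitrary \<open>C\<close>.\<close>

lemma extend_from_halfspaces:
  fixes C :: "'i \<Rightarrow> (real^2) set"
  assumes "finite F" "\<forall>h\<in>F. \<exists>a b. a \<noteq> 0 \<and> h = {x. a \<bullet> x \<le> b}"
    and "solid_partition (\<Inter>F) I C" "I \<noteq> {}"
  shows "\<exists>V. solid_partition UNIV I V \<and> (\<forall>i\<in>I. V i \<inter> \<Inter>F = C i)"
  using assms
proof (induction F arbitrary: C rule: finite_induct)
  case empty
  then show ?case by (intro exI[of _ C]) simp
next
  case (insert h F)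
  then obtain a b where a: "a \<noteq> 0" "h = {x. a \<bullet> x \<le> b}" by auto
  have "closed h \<and> convex h" if "h \<in> F" for h
    using insert.prems(1) that by (auto simp: closed_halfspace_le convex_halfspace_le)
  then have "closed (\<Inter>F)" "convex (\<Inter>F)" by (auto intro: convex_Inter)
  moreover have "solid_partition (\<Inter>F \<inter> {x. a \<bullet> x \<le> b}) I C"
    using insert.prems(2) a(2) by (simp add: Int_commute)
  ultimately obtain W where W: "solid_partition (\<Inter>F) I W" "\<And>i. i \<in> I \<Longrightarrow> W i \<inter> h = C i"
    using extend_across_line[of "\<Inter>F" a b I C] a insert.prems(3) by blast
  obtain V where V: "solid_partition UNIV I V" "\<forall>i\<in>I. V i \<inter> \<Inter>F = W i"
    using insert.IH[OF _ W(1)] insert.prems by auto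
  have "V i \<inter> \<Inter>(insert h F) = C i" if "i \<in> I" for i
    using V(2) W(2)[OF that] that by auto
  then show ?case using V(1) by blast
qed

section \<open>Homothets inside the pieces of a polygon\<close>

text \<open>The induction covers all translates of \<open>B\<close>, since sliding leads to other
  translates than the given one. The coefficients add up to exactly 1, a condition that convex
  combinations preserve.\<close>

lemma solid_partition_homothets:
  fixes B :: "(real^2) set"
  assumes B: "polytope B"
  shows "solid_partition ((+) x ` B) I C \<Longrightarrow> I \<noteq> {} \<Longrightarrow>
    \<exists>h t. (\<forall>i\<in>I. 0 \<le> h i \<and> (\<forall>y\<in>B. h i *\<^sub>R y + t i \<in> C i)) \<and> sum h I = 1"
proof (induction "card I" arbitrary: x I C rule: less_induct)
  case less
  note part = less.prems(1)
  have fin: "finite I" and cov: "(\<Union>i\<in>I. C i) = (+) x ` B"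
    and Cint: "\<And>i. i \<in> I \<Longrightarrow> interior (C i) \<noteq> {}"
    using part by (simp_all add: solid_partition_def)
  have Bc: "compact B" and Bv: "convex B"
    using B by (simp_all add: polytope_imp_compact polytope_imp_convex)
  show ?case
  proof (cases "card I = 1")
    case True
    then obtain i where i: "I = {i}" by (auto simp: card_1_singleton_iff)
    have "C i = (+) x ` B" using cov i by simp
    then have "\<forall>y\<in>B. 1 *\<^sub>R y + x \<in> C i" by (auto simp: add.commute)
    then show ?thesis using i by (intro exI[of _ "\<lambda>_. 1"] exI[of _ "\<lambda>_. x"]) simp
  next
    case False
    have "card I \<noteq> 0" using fin less.prems(2) by simp
    then have "\<exists>i0\<in>I. \<exists>i1\<in>I. i0 \<noteq> i1"
      using False card_1_singleton_iff[of I] less.prems(2) by (metis One_nat_def is_singletonI' is_singleton_altdef)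
    then obtain i0 i1 where i01: "i0 \<in> I" "i1 \<in> I" "i0 \<noteq> i1" by blast
    have "polyhedron ((+) x ` B)" using B polytope_translation_eq polytope_imp_polyhedron by blast
    then obtain F where F: "finite F" "(+) x ` B = \<Inter>F" "\<forall>h\<in>F. \<exists>a b. a \<noteq> 0 \<and> h = {x. a \<bullet> x \<le> b}"
      unfolding polyhedron_def by blast
    obtain V where V: "solid_partition UNIV I V" and VC: "\<And>i. i \<in> I \<Longrightarrow> V i \<inter> (+) x ` B = C i"
      using extend_from_halfspaces[OF F(1,3), of I C] part less.prems(2) unfolding F(2) by blast
    have Vcov: "(\<Union>i\<in>I. V i) = UNIV"
      and Vcl: "\<And>i. i \<in> I \<Longrightarrow> closed (V i)" and Vcv: "\<And>i. i \<in> I \<Longrightarrow> convex (V i)"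
      and Vint: "\<And>i. i \<in> I \<Longrightarrow> interior (V i) \<noteq> {}"
      and Vdis: "\<forall>i\<in>I. \<forall>j\<in>I. i \<noteq> j \<longrightarrow> interior (V i \<inter> V j) = {}"
      using V by (simp_all add: solid_partition_def del: interior_Int)
    obtain u c where u: "u \<noteq> 0" "\<And>x. x \<in> V i0 \<Longrightarrow> u \<bullet> x \<le> c" "\<And>x. x \<in> V i1 \<Longrightarrow> c \<le> u \<bullet> x"
      using separating_hyperplane_interior[OF Vcl[OF i01(1)] Vcv[OF i01(1)] Vint[OF i01(1)]
        Vcl[OF i01(2)] Vcv[OF i01(2)] Vint[OF i01(2)]] Vdis i01 by blast
    \<comment> \<open>Sliding along \<open>u\<close> keeps the set of admissible times bounded:
      meeting \<open>V i0\<close> bounds \<open>\<tau>\<close> from above, meeting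
      \<open>V i1\<close> from below.\<close>
    define K where "K \<tau> = (+) (x + \<tau> *\<^sub>R u) ` B" for \<tau> :: real
    have Kcv: "convex (K \<tau>)" and Kc: "compact (K \<tau>)" for \<tau>
      unfolding K_def using Bv compact_translation[OF Bc] by (simp_all add: convex_translation_eq)
    have "interior B \<noteq> {}"
    proof -
      obtain i where "i \<in> I" using less.prems(2) by blast
      then have "C i \<subseteq> (+) x ` B" using VC by blast
      then have "interior (C i) \<subseteq> (+) x ` interior B"
        using interior_mono[of "C i" "(+) x ` B"] by (simp add: interior_translation)
      then show ?thesis using Cint[OF \<open>i \<in> I\<close>] by auto
    qed
    then have Kint: "interior (K \<tau>) \<noteq> {}" for \<tau> by (simp add: K_def interior_translation)
    define \<Theta> where "\<Theta> = {\<tau>. \<forall>i\<in>I. V i \<inter> K \<tau> \<noteq> {}}"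
    \<comment> \<open>At an extreme time of \<open>\<Theta>\<close> some piece only touches the translate, so that the others
      already partition it.\<close>
    have event: "\<exists>h t. (\<forall>i\<in>I. 0 \<le> h i \<and> (\<forall>y\<in>B. h i *\<^sub>R y + t i \<in> V i \<inter> K \<tau>)) \<and> sum h I = 1"
      if \<tau>: "\<tau> \<in> \<Theta>" and ext: "\<And>\<delta>. \<delta> > 0 \<Longrightarrow> \<tau> + \<delta> * \<sigma> \<notin> \<Theta>" for \<tau> \<sigma>
    proof -
      define I' where "I' = {i\<in>I. interior (V i \<inter> K \<tau>) \<noteq> {}}"
      \<comment> \<open>Otherwise every piece has a point interior to its intersection with
        \<open>K \<tau>\<close>. A slightly moved translate still contains these points, so a small
        step in direction \<open>\<sigma>\<close> would stay in \<open>\<Theta>\<close>.\<close>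
      have "I' \<noteq> I"
      proof
        assume "I' = I"
        then have "\<forall>i\<in>I. \<exists>q. q \<in> interior (V i \<inter> K \<tau>)" unfolding I'_def by blast
        from bchoice[OF this] obtain q where q: "\<And>i. i \<in> I \<Longrightarrow> q i \<in> interior (V i \<inter> K \<tau>)" by blast
        have "\<forall>\<^sub>F \<delta> in at_right 0. q i - (\<delta> * \<sigma>) *\<^sub>R u \<in> interior (V i \<inter> K \<tau>)" if "i \<in> I" for i
        proof (rule topological_tendstoD[OF _ open_interior])
          have "((\<lambda>\<delta>. q i - (\<delta> * \<sigma>) *\<^sub>R u) \<longlongrightarrow> q i - (0 * \<sigma>) *\<^sub>R u) (at_right 0)"
            by (intro tendsto_intros)
          then show "((\<lambda>\<delta>. q i - (\<delta> * \<sigma>) *\<^sub>R u) \<longlongrightarrow> q i) (at_right 0)" by simp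
        qed (use q that in blast)
        then have "\<forall>\<^sub>F \<delta> in at_right 0. \<forall>i\<in>I. q i - (\<delta> * \<sigma>) *\<^sub>R u \<in> interior (V i \<inter> K \<tau>)"
          by (intro eventually_ball_finite fin) blast
        moreover have "\<forall>\<^sub>F \<delta> in at_right (0::real). 0 < \<delta>" by (rule eventually_at_right_less)
        ultimately have "\<forall>\<^sub>F \<delta> in at_right (0::real). 0 < \<delta> \<and> (\<forall>i\<in>I. q i - (\<delta> * \<sigma>) *\<^sub>R u \<in> interior (V i \<inter> K \<tau>))"
          by eventually_elim simp
        then obtain \<delta> where \<delta>: "\<delta> > 0" "\<And>i. i \<in> I \<Longrightarrow> q i - (\<delta> * \<sigma>) *\<^sub>R u \<in> interior (V i \<inter> K \<tau>)"
          using eventually_happens'[OF trivial_limit_at_right_real] by blast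
        have "q i \<in> V i \<inter> K (\<tau> + \<delta> * \<sigma>)" if i: "i \<in> I" for i
        proof -
          have "q i - (\<delta> * \<sigma>) *\<^sub>R u \<in> K \<tau>" "q i \<in> V i"
            using \<delta>(2)[OF i] q[OF i] interior_subset[of "V i \<inter> K \<tau>"] by blast+
          then obtain y where "y \<in> B" "q i - (\<delta> * \<sigma>) *\<^sub>R u = x + \<tau> *\<^sub>R u + y" by (auto simp: K_def)
          then have "q i = x + (\<tau> + \<delta> * \<sigma>) *\<^sub>R u + y" by (simp add: algebra_simps)
          then show ?thesis using \<open>y \<in> B\<close> \<open>q i \<in> V i\<close> by (simp add: K_def)
        qed
        then have "\<tau> + \<delta> * \<sigma> \<in> \<Theta>" unfolding \<Theta>_def by blast
        then show False using ext \<delta>(1) by blast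
      qed
      then have sub: "I' \<subset> I" by (auto simp: I'_def)
      have "K \<tau> \<subseteq> closure (interior (K \<tau>))"
        using convex_closure_interior[OF Kcv Kint] closure_subset[of "K \<tau>"] by simp
      then have K': "K \<tau> \<subseteq> (\<Union>i\<in>I'. V i \<inter> K \<tau>)"
        unfolding I'_def using Vcov
        by (intro closed_cover_nonempty_interior fin closed_Int Vcl compact_imp_closed Kc) auto
      then have ne: "I' \<noteq> {}" using Kint[of \<tau>] interior_subset[of "K \<tau>"] by auto
      have "solid_partition (K \<tau>) I' (\<lambda>i. V i \<inter> K \<tau>)"
        unfolding solid_partition_def
      proof (intro conjI ballI impI)
        show "finite I'" using fin sub finite_subset by blast
        show "(\<Union>i\<in>I'. V i \<inter> K \<tau>) = K \<tau>" using K' by blast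
        fix i assume "i \<in> I'"
        then have i: "i \<in> I" using sub by blast
        show "closed (V i \<inter> K \<tau>)" by (intro closed_Int Vcl compact_imp_closed Kc i)
        show "convex (V i \<inter> K \<tau>)" by (intro convex_Int Vcv Kcv i)
        show "interior (V i \<inter> K \<tau>) \<noteq> {}" using \<open>i \<in> I'\<close> unfolding I'_def by blast
        fix j assume "j \<in> I'" "i \<noteq> j"
        then have "interior (V i \<inter> V j) = {}" using Vdis i sub by blast
        moreover have "interior ((V i \<inter> K \<tau>) \<inter> (V j \<inter> K \<tau>)) \<subseteq> interior (V i \<inter> V j)"
          by (rule interior_mono) blast
        ultimately show "interior ((V i \<inter> K \<tau>) \<inter> (V j \<inter> K \<tau>)) = {}" by (simp only: subset_empty)
      qed
      then obtain h t where ht: "\<forall>i\<in>I'. 0 \<le> h i \<and> (\<forall>y\<in>B. h i *\<^sub>R y + t i \<in> V i \<inter> K \<tau>)" "sum h I' = 1"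
        using less.hyps[OF psubset_card_mono[OF fin sub], of "x + \<tau> *\<^sub>R u" "\<lambda>i. V i \<inter> K \<tau>"] ne
        unfolding K_def by blast
      \<comment> \<open>Because \<open>\<tau>\<close> lies in \<open>\<Theta>\<close>, even a lost
        piece meets the translate. Such a point serves as its translation vector, with coefficient
        0.\<close>
      have "\<forall>i\<in>I. \<exists>q. q \<in> V i \<inter> K \<tau>" using \<tau> unfolding \<Theta>_def by blast
      from bchoice[OF this] obtain q where q: "\<And>i. i \<in> I \<Longrightarrow> q i \<in> V i \<inter> K \<tau>" by blast
      define h' where "h' i = (if i \<in> I' then h i else 0)" for i
      define t' where "t' i = (if i \<in> I' then t i else q i)" for i
      have "sum h' I = sum h I'"
        using sum.inter_restrict[OF fin, of h I'] sub by (simp add: h'_def Int_absorb1 psubset_imp_subset)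
      moreover have "\<forall>i\<in>I. 0 \<le> h' i \<and> (\<forall>y\<in>B. h' i *\<^sub>R y + t' i \<in> V i \<inter> K \<tau>)"
        using ht(1) q by (simp add: h'_def t'_def)
      ultimately show ?thesis using ht(2) by metis
    qed
    have \<Theta>0: "0 \<in> \<Theta>"
    proof -
      have "C i \<noteq> {}" if "i \<in> I" for i using Cint[OF that] interior_subset by fastforce
      then show ?thesis using VC by (simp add: \<Theta>_def K_def)
    qed
    \<comment> \<open>A translate of \<open>B\<close> meets \<open>V i\<close> exactly when its
      translation vector is a difference of a point of \<open>V i\<close> and a point of
      \<open>B\<close>. These differences form a closed set, as \<open>V i\<close> is closed and
      \<open>B\<close> compact.\<close>
    have \<Theta>eq: "\<Theta> = (\<Inter>i\<in>I. (\<lambda>\<tau>. x + \<tau> *\<^sub>R u) -` (\<Union>v\<in>V i. \<Union>y\<in>B. {v - y}))"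
    proof -
      have "V i \<inter> K \<tau> \<noteq> {} \<longleftrightarrow> x + \<tau> *\<^sub>R u \<in> (\<Union>v\<in>V i. \<Union>y\<in>B. {v - y})" for i \<tau>
        by (force simp: K_def algebra_simps)
      then show ?thesis by (auto simp: \<Theta>_def)
    qed
    have \<Theta>cl: "closed \<Theta>"
      unfolding \<Theta>eq
      by (intro closed_INT ballI continuous_closed_vimage closed_compact_differences Vcl Bc continuous_intros)
    obtain N where N: "\<And>y. y \<in> B \<Longrightarrow> norm y \<le> N" using compact_imp_bounded[OF Bc] unfolding bounded_iff by blast
    have "\<bar>\<tau>\<bar> \<le> (\<bar>c\<bar> + norm u * N + \<bar>u \<bullet> x\<bar>) / (u \<bullet> u)" if \<tau>: "\<tau> \<in> \<Theta>" for \<tau>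
    proof -
      have "V i0 \<inter> K \<tau> \<noteq> {}" "V i1 \<inter> K \<tau> \<noteq> {}" using \<tau> i01 by (simp_all add: \<Theta>_def)
      then obtain y y' where y: "y \<in> B" "x + \<tau> *\<^sub>R u + y \<in> V i0" "y' \<in> B" "x + \<tau> *\<^sub>R u + y' \<in> V i1"
        by (auto simp: K_def)
      have bd: "\<bar>u \<bullet> y\<bar> \<le> norm u * N" if "y \<in> B" for y
        using Cauchy_Schwarz_ineq2[of u y] mult_left_mono[OF N[OF that], of "norm u"] by simp
      have "u \<bullet> x + \<tau> * (u \<bullet> u) + u \<bullet> y \<le> c" "c \<le> u \<bullet> x + \<tau> * (u \<bullet> u) + u \<bullet> y'"
        using u(2)[OF y(2)] u(3)[OF y(4)] by (simp_all add: inner_add_right)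
      then have "\<bar>\<tau> * (u \<bullet> u)\<bar> \<le> \<bar>c\<bar> + norm u * N + \<bar>u \<bullet> x\<bar>" using bd[OF y(1)] bd[OF y(3)] by linarith
      then show ?thesis using u(1) by (simp add: abs_mult pos_le_divide_eq)
    qed
    then have "bounded \<Theta>" unfolding bounded_iff real_norm_def by blast
    with \<Theta>cl have \<Theta>c: "compact \<Theta>" by (simp add: compact_eq_bounded_closed)
    obtain b where b: "b \<in> \<Theta>" "\<And>\<tau>. \<tau> \<in> \<Theta> \<Longrightarrow> \<tau> \<le> b" using compact_attains_sup[OF \<Theta>c] \<Theta>0 by blast
    obtain a where a: "a \<in> \<Theta>" "\<And>\<tau>. \<tau> \<in> \<Theta> \<Longrightarrow> a \<le> \<tau>" using compact_attains_inf[OF \<Theta>c] \<Theta>0 by blast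
    have "b + \<delta> * 1 \<notin> \<Theta>" if "\<delta> > 0" for \<delta> using b(2)[of "b + \<delta> * 1"] that by auto
    from event[OF b(1) this] obtain hb tb where
      hb: "\<And>i. i \<in> I \<Longrightarrow> 0 \<le> hb i" "\<And>i y. i \<in> I \<Longrightarrow> y \<in> B \<Longrightarrow> hb i *\<^sub>R y + tb i \<in> V i \<inter> K b" "sum hb I = 1"
      by blast
    have "a + \<delta> * (- 1) \<notin> \<Theta>" if "\<delta> > 0" for \<delta> using a(2)[of "a + \<delta> * (- 1)"] that by auto
    from event[OF a(1) this] obtain ha ta where
      ha: "\<And>i. i \<in> I \<Longrightarrow> 0 \<le> ha i" "\<And>i y. i \<in> I \<Longrightarrow> y \<in> B \<Longrightarrow> ha i *\<^sub>R y + ta i \<in> V i \<inter> K a" "sum ha I = 1"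
      by blast
    have ab: "a \<le> 0" "0 \<le> b" using a(2) b(2) \<Theta>0 by auto
    \<comment> \<open>The weight that brings the times \<open>a\<close> and \<open>b\<close> back to
      0, the time of the given translate. If \<open>a = b\<close>, both are 0 because
      \<open>a \<le> 0 \<le> b\<close>, and any weight would do.\<close>
    define l where "l = (if a = b then 0 else - a / (b - a))"
    have l: "0 \<le> l" "l \<le> 1" "(1 - l) * a + l * b = 0"
      using ab by (auto simp: l_def field_simps)
    define h where "h i = (1 - l) * ha i + l * hb i" for i
    define t where "t i = (1 - l) *\<^sub>R ta i + l *\<^sub>R tb i" for i
    have "sum h I = 1"
      by (simp add: h_def sum.distrib flip: sum_distrib_left) (simp add: ha(3) hb(3))
    moreover have "0 \<le> h i" if "i \<in> I" for i using ha(1) hb(1) l that by (simp add: h_def)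
    \<comment> \<open>Convexity of \<open>V i\<close> keeps the combination in \<open>V i\<close>.
      Convexity of \<open>B\<close> and the choice of \<open>l\<close> place it in the given
      translate. The two sets meet in \<open>C i\<close>.\<close>
    moreover have "h i *\<^sub>R y + t i \<in> C i" if i: "i \<in> I" and y: "y \<in> B" for i y
    proof -
      let ?p = "ha i *\<^sub>R y + ta i" and ?q = "hb i *\<^sub>R y + tb i"
      have eq: "h i *\<^sub>R y + t i = (1 - l) *\<^sub>R ?p + l *\<^sub>R ?q"
        by (simp add: h_def t_def algebra_simps)
      have p: "?p \<in> V i" "?p \<in> K a" and q: "?q \<in> V i" "?q \<in> K b" using ha(2)[OF i y] hb(2)[OF i y] by auto
      obtain y1 y2 where y12: "y1 \<in> B" "?p = x + a *\<^sub>R u + y1" "y2 \<in> B" "?q = x + b *\<^sub>R u + y2"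
        using p(2) q(2) by (auto simp: K_def)
      have "h i *\<^sub>R y + t i \<in> V i" unfolding eq by (rule convexD_alt[OF Vcv[OF i] p(1) q(1) l(1,2)])
      moreover have "h i *\<^sub>R y + t i = x + ((1 - l) * a + l * b) *\<^sub>R u + ((1 - l) *\<^sub>R y1 + l *\<^sub>R y2)"
        unfolding eq y12 by (simp add: algebra_simps)
      then have "h i *\<^sub>R y + t i \<in> (+) x ` B"
        using convexD_alt[OF Bv y12(1,3) l(1,2)] l(3) by simp
      ultimately show ?thesis using VC[OF i] by blast
    qed
    ultimately show ?thesis by blast
  qed
qed

section \<open>From polygons to convex bodies\<close>

lemma rB_ge:
  assumes "0 \<le> h" "\<And>x. x \<in> B \<Longrightarrow> h *\<^sub>R x + t \<in> C"
  shows "ereal h \<le> rB B C"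
  unfolding rB_def using assms by (intro Sup_upper imageI) auto

theorem mainTheorem8:
  fixes B :: "(real^2) set" and k :: nat and C :: "nat \<Rightarrow> (real^2) set"
  assumes "convex_body B"
    and "convex_partition B k C"
    and "\<forall>i<k. C i \<noteq> {}"
  shows "(\<Sum>i<k. rB B (C i)) \<ge> 1"
proof -
  have Bc: "compact B" and Bv: "convex B" and Bi: "interior B \<noteq> {}"
    using assms(1) by (simp_all add: convex_body_def)
  have cov: "(\<Union>i<k. C i) = B" and Ccl: "\<And>i. i < k \<Longrightarrow> closed (C i)" and Ccv: "\<And>i. i < k \<Longrightarrow> convex (C i)"
    and Cdis: "\<And>i j. i < k \<Longrightarrow> j < k \<Longrightarrow> i \<noteq> j \<Longrightarrow> interior (C i) \<inter> interior (C j) = {}"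
    using assms(2) by (simp_all add: convex_partition_def)
  obtain z where z: "z \<in> interior B" using Bi by blast
  obtain r where r: "r > 0" "cball z r \<subseteq> interior B"
    using open_contains_cball[of "interior B"] z by auto
  have approx: "ereal (1 - e) \<le> (\<Sum>i<k. rB B (C i))" if e: "0 < e" "e < 1" for e
  proof -
    \<comment> \<open>\<open>K\<close> is \<open>B\<close> shrunk by the factor \<open>1 - e\<close>
      towards the interior point \<open>z\<close>, hence a compact subset of the interior.\<close>
    define K where "K = (\<lambda>x. x - e *\<^sub>R (x - z)) ` B"
    have "compact K" unfolding K_def by (intro compact_continuous_image Bc continuous_intros)
    \<comment> \<open>The ball is included so that the polygon \<open>P\<close> visibly has interior
      points.\<close>
    then have "compact (K \<union> cball z r)" by (intro compact_Un compact_cball)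
    moreover have "K \<subseteq> interior B"
      unfolding K_def using mem_interior_convex_shrink[OF Bv z] e by auto
    ultimately obtain P where P: "polytope P" "K \<union> cball z r \<subseteq> P" "P \<subseteq> interior B"
      using polytope_between_compact_open[of "K \<union> cball z r" "interior B"] r(2) Bv
      by (metis convex_interior le_sup_iff open_interior)
    have Pcv: "convex P" and Pcl: "closed P" using P(1) by (simp_all add: polytope_imp_convex polytope_imp_closed)
    have "ball z r \<subseteq> interior P"
      using P(2) ball_subset_cball[of z r] by (intro interior_maximal) auto
    then have Pint: "interior P \<noteq> {}" using r(1) by auto
    have PB: "P \<subseteq> B" using P(3) interior_subset by blast
    define I where "I = {i\<in>{..<k}. interior (C i \<inter> P) \<noteq> {}}"
    have Ik: "i < k" if "i \<in> I" for i using that by (simp add: I_def)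
    have "P \<subseteq> closure (interior P)"
      using convex_closure_interior[OF Pcv Pint] closure_subset[of P] by simp
    then have cov': "P \<subseteq> (\<Union>i\<in>I. C i \<inter> P)"
      unfolding I_def using cov PB
      by (intro closed_cover_nonempty_interior closed_Int Ccl Pcl) auto
    then have ne: "I \<noteq> {}" using Pint interior_subset[of P] by auto
    have "solid_partition ((+) 0 ` P) I (\<lambda>i. C i \<inter> P)"
      unfolding solid_partition_def
    proof (intro conjI ballI impI)
      show "finite I" by (simp add: I_def)
      show "(\<Union>i\<in>I. C i \<inter> P) = (+) 0 ` P" using cov' by auto
      fix i assume i: "i \<in> I"
      show "closed (C i \<inter> P)" by (intro closed_Int Ccl Pcl Ik i)
      show "convex (C i \<inter> P)" by (intro convex_Int Ccv Pcv Ik i)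
      show "interior (C i \<inter> P) \<noteq> {}" using i unfolding I_def by blast
      fix j assume "j \<in> I" "i \<noteq> j"
      then show "interior ((C i \<inter> P) \<inter> (C j \<inter> P)) = {}" using Cdis[OF Ik[OF i] Ik] by auto
    qed
    from solid_partition_homothets[OF P(1) this ne] obtain h t where
      h0: "\<And>i. i \<in> I \<Longrightarrow> 0 \<le> h i" and ht: "\<And>i y. i \<in> I \<Longrightarrow> y \<in> P \<Longrightarrow> h i *\<^sub>R y + t i \<in> C i"
      and sum: "sum h I = 1" by blast
    \<comment> \<open>A homothet of \<open>P\<close> with ratio \<open>h i\<close> contains one of
      \<open>B\<close> with ratio \<open>(1 - e) * h i\<close>. A piece outside \<open>I\<close> is
      nonempty, so it contains a point, which is a homothet with ratio 0; its \<open>rB\<close> is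
      therefore at least 0 and not \<open>-\<infinity>\<close>.\<close>
    define g where "g i = (if i \<in> I then (1 - e) * h i else 0)" for i
    have "ereal (g i) \<le> rB B (C i)" if "i < k" for i
    proof (cases "i \<in> I")
      case True
      have "((1 - e) * h i) *\<^sub>R x + (h i *\<^sub>R e *\<^sub>R z + t i) \<in> C i" if "x \<in> B" for x
      proof -
        have "x - e *\<^sub>R (x - z) \<in> P" using that P(2) by (auto simp: K_def)
        from ht[OF True this] show ?thesis by (simp add: algebra_simps)
      qed
      then show ?thesis using True h0[OF True] e
        by (auto simp: g_def intro!: rB_ge[where t = "h i *\<^sub>R e *\<^sub>R z + t i"])
    next
      case False
      obtain q where "q \<in> C i" using assms(3) \<open>i < k\<close> by blast
      then show ?thesis using False by (auto simp: g_def intro!: rB_ge[where t = q])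
    qed
    then have "(\<Sum>i<k. ereal (g i)) \<le> (\<Sum>i<k. rB B (C i))" by (intro sum_mono) simp
    moreover have "(\<Sum>i<k. g i) = 1 - e"
    proof -
      have "{..<k} \<inter> I = I" using Ik by auto
      then have "(\<Sum>i<k. g i) = (\<Sum>i\<in>I. (1 - e) * h i)"
        using sum.inter_restrict[of "{..<k}" "\<lambda>i. (1 - e) * h i" I] by (simp add: g_def)
      also have "\<dots> = 1 - e" by (simp add: sum flip: sum_distrib_left)
      finally show ?thesis .
    qed
    ultimately show ?thesis by simp
  qed
  show ?thesis
  proof (rule ereal_le_epsilon2)
    fix e :: real assume e: "0 < e"
    \<comment> \<open>The minimum keeps \<open>e'\<close> below 1, as \<open>approx\<close>
      requires.\<close>
    define e' where "e' = min e (1/2)"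
    have "(1::ereal) = ereal (1 - e') + ereal e'" by (simp add: one_ereal_def)
    also have "\<dots> \<le> (\<Sum>i<k. rB B (C i)) + ereal e"
      by (intro add_mono approx) (use e in \<open>auto simp: e'_def\<close>)
    finally show "1 \<le> (\<Sum>i<k. rB B (C i)) + ereal e" .
  qed
qed

end
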